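(* Let $\mu>0$, $\alpha<-2$, $\theta>0$ be real numbers, and let $d(p)=\mu s(p)$ with $s(p)=\dfrac{1}{1+e^{\alpha+\theta p}}$. Let $\epsilon(p)=-p\theta\,[1-s(p)]$ be the price elasticity of demand, and let $p_{\mathrm{inf}}$ be the inflection point price of $d$. Then $\epsilon(p_{\mathrm{inf}})\neq -1$, and hence $p_{\mathrm{inf}}$ is not the revenue-maximizing price, i.e. $p_{\mathrm{inf}}$ does not maximize $R(p)=p\,d(p)$ over $p\ge 0$.
   Context: The price elasticity of demand is $\epsilon(p)=p\,d'(p)/d(p)$, which for this $d$ equals $-p\theta[1-s(p)]$. The inflection point price $p_{\mathrm{inf}}$ is the price at which $d''(p)=0$; explicitly, $p_{\mathrm{inf}}=-\alpha/\theta$. The revenue function is $R(p)=p\,d(p)$ on the feasible price domain $p\ge 0$. *)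

theory Defs
  imports "HOL-Analysis.Derivative"
begin

definition logit_share :: "real \<Rightarrow> real \<Rightarrow> real \<Rightarrow> real" where
  "logit_share \<alpha> \<theta> p = 1 / (1 + exp (\<alpha> + \<theta> * p))"

definition logit_demand :: "real \<Rightarrow> real \<Rightarrow> real \<Rightarrow> real \<Rightarrow> real" where
  "logit_demand \<mu> \<alpha> \<theta> p = \<mu> * logit_share \<alpha> \<theta> p"

definition price_elasticity :: "(real \<Rightarrow> real) \<Rightarrow> real \<Rightarrow> real" where
  "price_elasticity d p = p * deriv d p / d p"

(* Meaningful only for demand curves whose second derivative exists and has exactly one zero. *)
definition inflection_price :: "(real \<Rightarrow> real) \<Rightarrow> real" where
  "inflection_price d = (THE p. deriv (deriv d) p = 0)"

definition revenue :: "(real \<Rightarrow> real) \<Rightarrow> real \<Rightarrow> real" where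
  "revenue d p = p * d p"

end

theory Submission
  imports Defs
begin

text \<open>The share satisfies the logistic equation \<open>s' = -\<theta> s (1 - s)\<close>, which gives the elasticity and
  \<open>d'' = \<mu> \<theta>\<^sup>2 s (1 - s) (1 - 2 s)\<close>. The inflection point is therefore where \<open>s = 1/2\<close>, and the
  elasticity there is \<open>\<alpha>/2 < -1\<close>. Since \<open>R' = d (1 + \<epsilon>)\<close> and the inflection price is interior to
  \<open>p \<ge> 0\<close>, it is not even a local maximum of the revenue.\<close>

lemma logit_share_pos: "logit_share \<alpha> \<theta> p > 0"
  by (simp add: logit_share_def add_pos_pos)

lemma logit_share_less_1: "logit_share \<alpha> \<theta> p < 1"
  by (simp add: logit_share_def add_pos_pos)

lemma logit_share_eq_half_iff: "logit_share \<alpha> \<theta> p = 1 / 2 \<longleftrightarrow> \<alpha> + \<theta> * p = 0"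
proof -
  have "1 + exp (\<alpha> + \<theta> * p) \<noteq> 0"
    using exp_gt_zero[of "\<alpha> + \<theta> * p"] by linarith
  then show ?thesis
    by (auto simp: logit_share_def field_simps)
qed

text \<open>With \<open>E = exp (\<alpha> + \<theta> * p)\<close>, differentiation gives
  \<open>- \<theta> * E / (1 + E)\<^sup>2\<close>, and \<open>E / (1 + E)\<close> is one minus the
  share.\<close>

lemma has_real_derivative_logit_share:
  "(logit_share \<alpha> \<theta> has_real_derivative - \<theta> * logit_share \<alpha> \<theta> p * (1 - logit_share \<alpha> \<theta> p)) (at p)"
proof -
  have nz: "1 + exp (\<alpha> + \<theta> * p) \<noteq> 0"
    using exp_gt_zero[of "\<alpha> + \<theta> * p"] by linarith
  show ?thesis
    unfolding logit_share_def[abs_def]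
    by (rule derivative_eq_intros refl nz | simp add: nz field_simps)+
qed

lemma has_real_derivative_logit_demand:
  "(logit_demand \<mu> \<alpha> \<theta> has_real_derivative
     - \<mu> * \<theta> * logit_share \<alpha> \<theta> p * (1 - logit_share \<alpha> \<theta> p)) (at p)"
  unfolding logit_demand_def[abs_def]
  by (rule derivative_eq_intros has_real_derivative_logit_share refl | simp)+

lemma deriv_logit_demand:
  "deriv (logit_demand \<mu> \<alpha> \<theta>) =
     (\<lambda>p. - \<mu> * \<theta> * logit_share \<alpha> \<theta> p * (1 - logit_share \<alpha> \<theta> p))"
  by (rule ext, rule DERIV_imp_deriv, rule has_real_derivative_logit_demand)

text \<open>The derivative of s (1 - s) is s' (1 - 2 s); the logistic equation then replaces s', and
  the two minus signs cancel.\<close>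

lemma deriv2_logit_demand:
  "deriv (deriv (logit_demand \<mu> \<alpha> \<theta>)) p =
     \<mu> * \<theta>\<^sup>2 * logit_share \<alpha> \<theta> p * (1 - logit_share \<alpha> \<theta> p) * (1 - 2 * logit_share \<alpha> \<theta> p)"
  unfolding deriv_logit_demand
  by (rule DERIV_imp_deriv)
    (rule derivative_eq_intros has_real_derivative_logit_share refl
      | simp add: algebra_simps power2_eq_square)+

text \<open>Since 0 < s < 1, only the factor 1 - 2 s of the second derivative can vanish. It does so
  at exactly one price, which gives the definite description in \<open>inflection_price\<close> its
  value.\<close>

lemma inflection_price_logit_demand:
  assumes "\<mu> \<noteq> 0" and "\<theta> \<noteq> 0"
  shows "inflection_price (logit_demand \<mu> \<alpha> \<theta>) = - \<alpha> / \<theta>"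
proof -
  have "deriv (deriv (logit_demand \<mu> \<alpha> \<theta>)) p = 0 \<longleftrightarrow> p = - \<alpha> / \<theta>" for p
  proof -
    have "deriv (deriv (logit_demand \<mu> \<alpha> \<theta>)) p = 0 \<longleftrightarrow> logit_share \<alpha> \<theta> p = 1 / 2"
      using assms logit_share_pos[of \<alpha> \<theta> p] logit_share_less_1[of \<alpha> \<theta> p]
      by (auto simp: deriv2_logit_demand)
    also have "\<dots> \<longleftrightarrow> p = - \<alpha> / \<theta>"
      unfolding logit_share_eq_half_iff using assms by (auto simp: field_simps)
    finally show ?thesis .
  qed
  then show ?thesis
    by (simp add: inflection_price_def)
qed

text \<open>Both \<mu> and one factor s cancel in d' / d.\<close>

lemma price_elasticity_logit_demand:
  assumes "\<mu> \<noteq> 0"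
  shows "price_elasticity (logit_demand \<mu> \<alpha> \<theta>) p = - p * \<theta> * (1 - logit_share \<alpha> \<theta> p)"
  using assms logit_share_pos[of \<alpha> \<theta> p]
  by (simp add: price_elasticity_def deriv_logit_demand logit_demand_def field_simps)

text \<open>First-order condition at an interior maximum, for an arbitrary demand curve: R' = d + p
  d' vanishes, and dividing by d gives the elasticity.\<close>

lemma price_elasticity_eq_minus_1_if_revenue_max:
  assumes max: "is_arg_max (revenue d) (\<lambda>p. p \<ge> 0) p"
    and "p > 0" and "d p \<noteq> 0" and diff: "d differentiable at p"
  shows "price_elasticity d p = -1"
proof -
  have "(d has_real_derivative deriv d p) (at p)"
    using diff by (simp add: DERIV_deriv_iff_real_differentiable)
  then have "(revenue d has_real_derivative d p + p * deriv d p) (at p)"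
    unfolding revenue_def[abs_def] by (auto intro!: derivative_eq_intros)
  \<comment> \<open>The radius p keeps every such q positive, hence feasible, so the constrained
    maximum is an unconstrained local one.\<close>
  moreover have "\<forall>q. \<bar>p - q\<bar> < p \<longrightarrow> revenue d q \<le> revenue d p"
    using max by (auto simp: is_arg_max_def not_less abs_less_iff)
  ultimately have "d p + p * deriv d p = 0"
    using DERIV_local_max \<open>p > 0\<close> by blast
  then show ?thesis
    using \<open>d p \<noteq> 0\<close> by (simp add: price_elasticity_def field_simps)
qed

theorem proposition2:
  fixes \<mu> \<alpha> \<theta> :: real and s d :: "real \<Rightarrow> real"
  assumes "\<mu> > 0" and "\<alpha> < -2" and "\<theta> > 0"
  defines "s \<equiv> logit_share \<alpha> \<theta>" and "d \<equiv> logit_demand \<mu> \<alpha> \<theta>"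
  shows "(\<forall>p. price_elasticity d p = - p * \<theta> * (1 - s p)) \<and>
    price_elasticity d (inflection_price d) \<noteq> -1 \<and>
    \<not> is_arg_max (revenue d) (\<lambda>p. p \<ge> 0) (inflection_price d)"
proof -
  let ?p = "inflection_price d"
  have p: "?p = - \<alpha> / \<theta>"
    using assms by (simp add: inflection_price_logit_demand)
  have elasticity: "price_elasticity d q = - q * \<theta> * (1 - s q)" for q
    using assms by (simp add: price_elasticity_logit_demand)
  have "s ?p = 1 / 2"
    using assms(3) unfolding s_def logit_share_eq_half_iff p by simp
  \<comment> \<open>At this price \<open>- ?p * \<theta>\<close> equals \<alpha>, and the remaining
    factor 1 - s is one half.\<close>
  then have "price_elasticity d ?p = \<alpha> / 2"
    using assms(3) unfolding elasticity by (simp add: p)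
  then have ne: "price_elasticity d ?p \<noteq> -1"
    using assms(2) by simp
  \<comment> \<open>A negative \<alpha> places the inflection price in the interior of the feasible
    domain, where the first-order condition applies.\<close>
  have "?p > 0"
    using assms(2,3) unfolding p by (simp add: divide_neg_pos)
  moreover have "d ?p \<noteq> 0"
    using assms(1) logit_share_pos[of \<alpha> \<theta> ?p] by (simp add: d_def logit_demand_def)
  moreover have "d differentiable at ?p"
    unfolding d_def real_differentiable_def using has_real_derivative_logit_demand by blast
  ultimately have "\<not> is_arg_max (revenue d) (\<lambda>p. p \<ge> 0) ?p"
    using ne price_elasticity_eq_minus_1_if_revenue_max by blast
  with elasticity ne show ?thesis by blast
qed

end
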